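(* Let $S\subset M$ be a nonempty geodesic convex subset and let $f:M\to\mathbb{R}$ be a differentiable function. Consider the problem of minimizing $f(x)$ subject to $x\in S$. If $\bar x$ is a local optimal solution of this problem and $S$ is a locally geodesic convex subset of $M$, then $-\mathrm{grad} f(\bar x)\in N_S(\bar x)$.
   Context: $M$ is a smooth, simply connected, Hausdorff $m$-dimensional manifold with a countable atlas, endowed with a Riemannian metric $\langle\cdot,\cdot\rangle$ with norm $\|\cdot\|$, exponential map $\exp$ and Riemannian distance $d$; $\mathrm{grad}f$ is the Riemannian gradient. A geodesic from $x$ to $y$ is minimal if its length is $d(x,y)$. $\bar x\in S$ is a local optimal solution if $f(x)\ge f(\bar x)$ for all $x\in S$ in some neighborhood of $\bar x$. Convexity: $A\subset M$ is geodesic convex if for any $x,y\in A$ there is a minimal geodesic from $x$ to $y$ lying in $A$ and such a minimal geodesic is unique within $A$. $A$ is strongly geodesic convex if for any $x,y\in A$ there is exactly one minimal geodesic of $M$ from $x$ to $y$ and it lies in $A$. For $p\in M$, the geodesic convex radius $r(p)>0$ is the largest number such that for all $0<r\le r(p)$ the open ball $\mathrm{Bal}_M(p,r)$ is strongly geodesic convex and each geodesic in $\mathrm{Bal}_M(p,r)$ is minimal. $C\subset M$ is locally geodesic convex if for every $p\in\mathrm{cl}(C)$ there is $0<\varepsilon(p)<r(p)$ such that $C\cap \mathrm{Bal}_M(p,\varepsilon(p))$ is strongly geodesic convex. $\mathrm{int}(C)$ denotes the union of all $k$-dimensional submanifolds of $M$ contained in $C$, where $k$ is the largest dimension of a submanifold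 of $M$ contained in $C$ (relative interior). Cones: for a locally geodesic convex set $C$ and $p\in C$, the tangent cone is $T_C(p)=\{v\in T_pM\setminus\{0\}:\exp_p\big(t\frac{v}{\|v\|}\big)\in\mathrm{int}(C)\text{ for some }0<t<\varepsilon(p)\}\cup\{0\}$, and the normal cone is $N_C(p)=\{u\in T_pM:\langle u,v\rangle_{T_pM}\le0\ \ \forall v\in T_C(p)\}$. *)

theory Defs
  imports "HOL-Analysis.Analysis"
begin

section \<open>Smooth maps between Euclidean spaces\<close>

(* Only meaningful for open S: the derivatives are unrestricted ones. *)
primrec Ck_on :: "'b::real_normed_vector set \<Rightarrow> nat \<Rightarrow> ('b \<Rightarrow> 'c::real_normed_vector) \<Rightarrow> bool" where
  "Ck_on S 0 f \<longleftrightarrow> continuous_on S f"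
| "Ck_on S (Suc k) f \<longleftrightarrow> (\<forall>x\<in>S. f differentiable (at x)) \<and>
     (\<forall>v. Ck_on S k (\<lambda>x. frechet_derivative f (at x) v))"

definition smooth_map_on :: "'b::real_normed_vector set \<Rightarrow> ('b \<Rightarrow> 'c::real_normed_vector) \<Rightarrow> bool" where
  "smooth_map_on S f \<longleftrightarrow> (\<forall>k. Ck_on S k f)"


section \<open>Riemannian manifolds\<close>

text \<open>The underlying set of a manifold is the whole type \<^typ>\<open>'a\<close>, with its class topology, and the
  dimension is \<open>m = CARD('n)\<close>. A chart is a domain together with a map that is relevant only on the
  domain.

  A tangent vector at \<open>p\<close> is the family of its coordinate vectors, one for each chart of the
  atlas around \<open>p\<close>, related by the derivatives of the coordinate changes; the family is \<open>0\<close> at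
  all other charts, so that equality of tangent vectors is equality of functions and the vector
  space operations are the pointwise ones.\<close>

type_synonym ('a, 'n) chart = "'a set \<times> ('a \<Rightarrow> real ^ 'n)"

type_synonym ('a, 'n) tvec = "('a, 'n) chart \<Rightarrow> real ^ 'n"

record ('a, 'n::finite) riem_struct =
  atlas :: "('a, 'n) chart set"
  metric :: "'a \<Rightarrow> ('a, 'n) tvec \<Rightarrow> ('a, 'n) tvec \<Rightarrow> real"

definition chart_inv :: "('a, 'n::finite) chart \<Rightarrow> real ^ 'n \<Rightarrow> 'a" where
  "chart_inv c = inv_into (fst c) (snd c)"

definition is_chart :: "('a::topological_space, 'n::finite) chart \<Rightarrow> bool" where
  "is_chart c \<longleftrightarrow> open (fst c) \<and> open (snd c ` fst c) \<and>
     homeomorphism (fst c) (snd c ` fst c) (snd c) (chart_inv c)"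

definition compatible :: "('a, 'n::finite) chart \<Rightarrow> ('a, 'n) chart \<Rightarrow> bool" where
  "compatible c c' \<longleftrightarrow>
     smooth_map_on (snd c ` (fst c \<inter> fst c')) (snd c' \<circ> chart_inv c) \<and>
     smooth_map_on (snd c' ` (fst c \<inter> fst c')) (snd c \<circ> chart_inv c')"

definition charts_at :: "('a, 'n::finite) riem_struct \<Rightarrow> 'a \<Rightarrow> ('a, 'n) chart set" where
  "charts_at M p = {c \<in> atlas M. p \<in> fst c}"

definition smooth_atlas :: "('a::topological_space, 'n::finite) chart set \<Rightarrow> bool" where
  "smooth_atlas A \<longleftrightarrow> (\<forall>c\<in>A. is_chart c) \<and> (\<Union>c\<in>A. fst c) = UNIV \<and>
     (\<forall>c\<in>A. \<forall>c'\<in>A. compatible c c')"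

definition maximal_atlas :: "('a::topological_space, 'n::finite) riem_struct \<Rightarrow> ('a, 'n) chart set" where
  "maximal_atlas M = {c. is_chart c \<and> (\<forall>c'\<in>atlas M. compatible c c')}"

definition tangent_space :: "('a, 'n::finite) riem_struct \<Rightarrow> 'a \<Rightarrow> ('a, 'n) tvec set" where
  "tangent_space M p = {v.
     (\<forall>c\<in>charts_at M p. \<forall>c'\<in>charts_at M p.
        v c' = frechet_derivative (snd c' \<circ> chart_inv c) (at (snd c p)) (v c)) \<and>
     (\<forall>c. c \<notin> charts_at M p \<longrightarrow> v c = 0)}"

definition tzero :: "('a, 'n::finite) tvec" where
  "tzero = (\<lambda>c. 0)"

definition tscale :: "real \<Rightarrow> ('a, 'n::finite) tvec \<Rightarrow> ('a, 'n) tvec" where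
  "tscale a v = (\<lambda>c. a *\<^sub>R v c)"

definition tadd :: "('a, 'n::finite) tvec \<Rightarrow> ('a, 'n) tvec \<Rightarrow> ('a, 'n) tvec" where
  "tadd v w = (\<lambda>c. v c + w c)"

definition tuminus :: "('a, 'n::finite) tvec \<Rightarrow> ('a, 'n) tvec" where
  "tuminus v = (\<lambda>c. - v c)"

text \<open>The tangent vector at \<open>p\<close> whose coordinate vector in the chart \<open>c\<close> is \<open>u\<close>.\<close>

definition coord_vec ::
    "('a, 'n::finite) riem_struct \<Rightarrow> ('a, 'n) chart \<Rightarrow> 'a \<Rightarrow> real ^ 'n \<Rightarrow> ('a, 'n) tvec" where
  "coord_vec M c p u = (\<lambda>c'. if c' \<in> charts_at M p
     then frechet_derivative (snd c' \<circ> chart_inv c) (at (snd c p)) u else 0)"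

text \<open>The matrix \<open>g\<^sub>i\<^sub>j\<close> of the metric in the chart \<open>c\<close>, at the point with coordinates \<open>x\<close>.\<close>

definition metric_matrix ::
    "('a, 'n::finite) riem_struct \<Rightarrow> ('a, 'n) chart \<Rightarrow> real ^ 'n \<Rightarrow> real ^ 'n ^ 'n" where
  "metric_matrix M c x = (\<chi> i j. metric M (chart_inv c x)
     (coord_vec M c (chart_inv c x) (axis i 1)) (coord_vec M c (chart_inv c x) (axis j 1)))"

definition riemannian_metric :: "('a::topological_space, 'n::finite) riem_struct \<Rightarrow> bool" where
  "riemannian_metric M \<longleftrightarrow>
     (\<forall>p. \<forall>u\<in>tangent_space M p. \<forall>v\<in>tangent_space M p. \<forall>w\<in>tangent_space M p. \<forall>a.
        metric M p u v = metric M p v u \<and>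
        metric M p (tadd u v) w = metric M p u w + metric M p v w \<and>
        metric M p (tscale a u) v = a * metric M p u v) \<and>
     (\<forall>p. \<forall>v\<in>tangent_space M p. v \<noteq> tzero \<longrightarrow> metric M p v v > 0) \<and>
     (\<forall>c\<in>atlas M. \<forall>i j. smooth_map_on (snd c ` fst c) (\<lambda>x. metric_matrix M c x $ i $ j))"

definition riemannian_manifold :: "('a::t2_space, 'n::finite) riem_struct \<Rightarrow> bool" where
  "riemannian_manifold M \<longleftrightarrow> smooth_atlas (atlas M) \<and> countable (atlas M) \<and> riemannian_metric M"

definition tnorm :: "('a, 'n::finite) riem_struct \<Rightarrow> 'a \<Rightarrow> ('a, 'n) tvec \<Rightarrow> real" where
  "tnorm M p v = sqrt (metric M p v v)"


section \<open>Curves, length and distance\<close>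

text \<open>The velocity of a curve on the interval \<open>I\<close>; derivatives at end points are one-sided.\<close>

definition velocity :: "('a, 'n::finite) riem_struct \<Rightarrow> real set \<Rightarrow> (real \<Rightarrow> 'a) \<Rightarrow> real \<Rightarrow> ('a, 'n) tvec" where
  "velocity M I \<gamma> t = (\<lambda>c. if c \<in> charts_at M (\<gamma> t)
     then vector_derivative (snd c \<circ> \<gamma>) (at t within I) else 0)"

definition C1_curve_on :: "('a::topological_space, 'n::finite) riem_struct \<Rightarrow> real set \<Rightarrow> (real \<Rightarrow> 'a) \<Rightarrow> bool" where
  "C1_curve_on M I \<gamma> \<longleftrightarrow> continuous_on I \<gamma> \<and>
     (\<forall>c\<in>atlas M.
        (\<forall>t\<in>I. \<gamma> t \<in> fst c \<longrightarrow> (snd c \<circ> \<gamma>) differentiable (at t within I)) \<and>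
        continuous_on {t\<in>I. \<gamma> t \<in> fst c} (\<lambda>t. velocity M I \<gamma> t c))"

text \<open>The set \<open>D\<close> consists of the nodes of a subdivision of the unit interval.\<close>

definition piecewise_C1_curve :: "('a::topological_space, 'n::finite) riem_struct \<Rightarrow> (real \<Rightarrow> 'a) \<Rightarrow> bool" where
  "piecewise_C1_curve M \<gamma> \<longleftrightarrow>
     (\<exists>D. finite D \<and> {0, 1} \<subseteq> D \<and> D \<subseteq> {0..1} \<and>
        (\<forall>a\<in>D. \<forall>b\<in>D. a < b \<and> {a<..<b} \<inter> D = {} \<longrightarrow> C1_curve_on M {a..b} \<gamma>))"

definition curve_length :: "('a, 'n::finite) riem_struct \<Rightarrow> (real \<Rightarrow> 'a) \<Rightarrow> real" where
  "curve_length M \<gamma> = integral {0..1} (\<lambda>t. tnorm M (\<gamma> t) (velocity M {0..1} \<gamma> t))"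

definition riem_dist :: "('a::topological_space, 'n::finite) riem_struct \<Rightarrow> 'a \<Rightarrow> 'a \<Rightarrow> real" where
  "riem_dist M x y = Inf {curve_length M \<gamma> | \<gamma>. piecewise_C1_curve M \<gamma> \<and> \<gamma> 0 = x \<and> \<gamma> 1 = y}"

definition riem_ball :: "('a::topological_space, 'n::finite) riem_struct \<Rightarrow> 'a \<Rightarrow> real \<Rightarrow> 'a set" where
  "riem_ball M p r = {q. riem_dist M p q < r}"


section \<open>Geodesics and the exponential map\<close>

definition christoffel ::
    "('a, 'n::finite) riem_struct \<Rightarrow> ('a, 'n) chart \<Rightarrow> real ^ 'n \<Rightarrow> 'n \<Rightarrow> 'n \<Rightarrow> 'n \<Rightarrow> real" where
  "christoffel M c x k i j =
     (let dg = (\<lambda>l a b. frechet_derivative (\<lambda>y. metric_matrix M c y $ a $ b) (at x) (axis l 1))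
      in (1/2) * (\<Sum>l\<in>UNIV. matrix_inv (metric_matrix M c x) $ k $ l *
                      (dg i j l + dg j i l - dg l i j)))"

text \<open>Geodesics are affinely parametrised by the unit interval, and two of them are the same if they
  agree there. Constant curves are included. In a chart the equation is
  \<open>x\<^sub>k'' = - (\<Sum>i j. \<Gamma>\<^sub>k\<^sub>i\<^sub>j x\<^sub>i' x\<^sub>j')\<close>.\<close>

definition geodesic :: "('a::topological_space, 'n::finite) riem_struct \<Rightarrow> (real \<Rightarrow> 'a) \<Rightarrow> bool" where
  "geodesic M \<gamma> \<longleftrightarrow> continuous_on {0..1} \<gamma> \<and>
     (\<forall>c\<in>atlas M. \<forall>t\<in>{0..1}. \<gamma> t \<in> fst c \<longrightarrow>
        (snd c \<circ> \<gamma>) differentiable (at t within {0..1}) \<and>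
        ((\<lambda>s. velocity M {0..1} \<gamma> s c) has_vector_derivative
           (\<chi> k. - (\<Sum>i\<in>UNIV. \<Sum>j\<in>UNIV. christoffel M c (snd c (\<gamma> t)) k i j *
                      velocity M {0..1} \<gamma> t c $ i * velocity M {0..1} \<gamma> t c $ j)))
          (at t within {0..1}))"

definition minimal_geodesic ::
    "('a::topological_space, 'n::finite) riem_struct \<Rightarrow> 'a \<Rightarrow> 'a \<Rightarrow> (real \<Rightarrow> 'a) \<Rightarrow> bool" where
  "minimal_geodesic M x y \<gamma> \<longleftrightarrow> geodesic M \<gamma> \<and> \<gamma> 0 = x \<and> \<gamma> 1 = y \<and>
     curve_length M \<gamma> = riem_dist M x y"

text \<open>\<open>M\<close> need not be complete, so the exponential map is only defined on a part of the
  tangent space, and \<open>exp_map M p v\<close> is meaningful only for \<open>v \<in> exp_domain M p\<close>. There the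
  choice is determined, because a geodesic is determined by its initial velocity.\<close>

definition exp_domain :: "('a::topological_space, 'n::finite) riem_struct \<Rightarrow> 'a \<Rightarrow> ('a, 'n) tvec set" where
  "exp_domain M p = {v \<in> tangent_space M p.
     \<exists>\<gamma>. geodesic M \<gamma> \<and> \<gamma> 0 = p \<and> velocity M {0..1} \<gamma> 0 = v}"

definition exp_map :: "('a::topological_space, 'n::finite) riem_struct \<Rightarrow> 'a \<Rightarrow> ('a, 'n) tvec \<Rightarrow> 'a" where
  "exp_map M p v = (SOME q. \<exists>\<gamma>. geodesic M \<gamma> \<and> \<gamma> 0 = p \<and> velocity M {0..1} \<gamma> 0 = v \<and> \<gamma> 1 = q)"


section \<open>Convexity\<close>

definition geodesic_convex :: "('a::topological_space, 'n::finite) riem_struct \<Rightarrow> 'a set \<Rightarrow> bool" where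
  "geodesic_convex M A \<longleftrightarrow> (\<forall>x\<in>A. \<forall>y\<in>A.
     \<exists>\<gamma>. minimal_geodesic M x y \<gamma> \<and> \<gamma> ` {0..1} \<subseteq> A \<and>
       (\<forall>\<gamma>'. minimal_geodesic M x y \<gamma>' \<and> \<gamma>' ` {0..1} \<subseteq> A \<longrightarrow> (\<forall>t\<in>{0..1}. \<gamma>' t = \<gamma> t)))"

definition strongly_geodesic_convex :: "('a::topological_space, 'n::finite) riem_struct \<Rightarrow> 'a set \<Rightarrow> bool" where
  "strongly_geodesic_convex M A \<longleftrightarrow> (\<forall>x\<in>A. \<forall>y\<in>A.
     \<exists>\<gamma>. minimal_geodesic M x y \<gamma> \<and> \<gamma> ` {0..1} \<subseteq> A \<and>
       (\<forall>\<gamma>'. minimal_geodesic M x y \<gamma>' \<longrightarrow> (\<forall>t\<in>{0..1}. \<gamma>' t = \<gamma> t)))"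

text \<open>The radius is \<open>\<infinity>\<close> if all radii have the required property, as in Euclidean space; otherwise
  the supremum is a maximum.\<close>

definition geodesic_convex_radius :: "('a::topological_space, 'n::finite) riem_struct \<Rightarrow> 'a \<Rightarrow> ereal" where
  "geodesic_convex_radius M p = Sup {ereal \<rho> | \<rho>. 0 < \<rho> \<and>
     (\<forall>r. 0 < r \<and> r \<le> \<rho> \<longrightarrow>
        strongly_geodesic_convex M (riem_ball M p r) \<and>
        (\<forall>\<gamma>. geodesic M \<gamma> \<and> \<gamma> ` {0..1} \<subseteq> riem_ball M p r \<longrightarrow>
              minimal_geodesic M (\<gamma> 0) (\<gamma> 1) \<gamma>))}"

definition local_convexity_radii ::
    "('a::topological_space, 'n::finite) riem_struct \<Rightarrow> 'a set \<Rightarrow> ('a \<Rightarrow> real) \<Rightarrow> bool" where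
  "local_convexity_radii M C \<epsilon> \<longleftrightarrow> (\<forall>p\<in>closure C. 0 < \<epsilon> p \<and>
     ereal (\<epsilon> p) < geodesic_convex_radius M p \<and>
     strongly_geodesic_convex M (C \<inter> riem_ball M p (\<epsilon> p)))"

definition locally_geodesic_convex :: "('a::topological_space, 'n::finite) riem_struct \<Rightarrow> 'a set \<Rightarrow> bool" where
  "locally_geodesic_convex M C \<longleftrightarrow> (\<exists>\<epsilon>. local_convexity_radii M C \<epsilon>)"


section \<open>Relative interior, tangent cone and normal cone\<close>

text \<open>Nonempty embedded submanifolds without boundary, given by slice charts. Allowing immersed
  submanifolds would not change \<open>rel_int\<close>, since these are locally embedded.\<close>

definition submanifold :: "('a::topological_space, 'n::finite) riem_struct \<Rightarrow> nat \<Rightarrow> 'a set \<Rightarrow> bool" where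
  "submanifold M k N \<longleftrightarrow> N \<noteq> {} \<and>
     (\<forall>p\<in>N. \<exists>c\<in>maximal_atlas M. p \<in> fst c \<and>
        (\<exists>L. subspace L \<and> dim L = k \<and> snd c ` (fst c \<inter> N) = snd c ` fst c \<inter> L))"

definition rel_int :: "('a::topological_space, 'n::finite) riem_struct \<Rightarrow> 'a set \<Rightarrow> 'a set" where
  "rel_int M C =
     \<Union>{N. N \<subseteq> C \<and> submanifold M (GREATEST k. \<exists>N'. N' \<subseteq> C \<and> submanifold M k N') N}"

text \<open>The parameter \<open>\<epsilon>\<close> is a function as in \<^const>\<open>local_convexity_radii\<close>.\<close>

definition tangent_cone ::
    "('a::topological_space, 'n::finite) riem_struct \<Rightarrow> 'a set \<Rightarrow> ('a \<Rightarrow> real) \<Rightarrow> 'a \<Rightarrow> ('a, 'n) tvec set" where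
  "tangent_cone M C \<epsilon> p = {v \<in> tangent_space M p - {tzero}.
     \<exists>t. 0 < t \<and> t < \<epsilon> p \<and> tscale (t / tnorm M p v) v \<in> exp_domain M p \<and>
         exp_map M p (tscale (t / tnorm M p v) v) \<in> rel_int M C} \<union> {tzero}"

definition normal_cone ::
    "('a::topological_space, 'n::finite) riem_struct \<Rightarrow> 'a set \<Rightarrow> ('a \<Rightarrow> real) \<Rightarrow> 'a \<Rightarrow> ('a, 'n) tvec set" where
  "normal_cone M C \<epsilon> p = {u \<in> tangent_space M p. \<forall>v\<in>tangent_cone M C \<epsilon> p. metric M p u v \<le> 0}"


section \<open>Optimisation\<close>

definition differentiable_function :: "('a, 'n::finite) riem_struct \<Rightarrow> ('a \<Rightarrow> real) \<Rightarrow> bool" where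
  "differentiable_function M f \<longleftrightarrow>
     (\<forall>p. \<forall>c\<in>charts_at M p. (f \<circ> chart_inv c) differentiable (at (snd c p)))"

text \<open>The right hand side of the equation is \<open>df\<^sub>p(v)\<close>, computed in any of the charts.\<close>

definition grad :: "('a, 'n::finite) riem_struct \<Rightarrow> ('a \<Rightarrow> real) \<Rightarrow> 'a \<Rightarrow> ('a, 'n) tvec" where
  "grad M f p = (THE u. u \<in> tangent_space M p \<and>
     (\<forall>v\<in>tangent_space M p. \<forall>c\<in>charts_at M p.
        metric M p u v = frechet_derivative (f \<circ> chart_inv c) (at (snd c p)) (v c)))"

definition local_optimal_solution :: "('a::topological_space \<Rightarrow> real) \<Rightarrow> 'a set \<Rightarrow> 'a \<Rightarrow> bool" where
  "local_optimal_solution f S x \<longleftrightarrow> x \<in> S \<and>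
     (\<exists>U. open U \<and> x \<in> U \<and> (\<forall>y\<in>S \<inter> U. f x \<le> f y))"

end

theory Submission
  imports Defs
begin

text \<open>Let \<open>v \<noteq> 0\<close> be in the tangent cone of \<open>S\<close> at \<open>p = xbar\<close>. By definition of the cone, some
  positive multiple \<open>w\<close> of \<open>v\<close>, of norm \<open>t < \<epsilon> p\<close>, is the initial velocity of a geodesic \<open>\<gamma>\<close> that
  starts at \<open>p\<close> and ends in \<open>S\<close>. The heart of the matter is that all of \<open>\<gamma>\<close> then lies in \<open>S\<close>
  (\<open>short_geodesic_subset\<close>); after that, \<open>f \<circ> \<gamma>\<close> has a one-sided local minimum at \<open>0\<close>, so its derivative
  there, which is the inner product of the gradient with \<open>w\<close>, is nonnegative
  (\<open>grad_along_geodesic_nonneg\<close>). Dividing by the positive factor and changing the sign gives the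
  inequality that defines the normal cone.

  To see that \<open>\<gamma>\<close> stays in \<open>S\<close>, note that a geodesic has constant speed (\<open>geodesic_constant_speed\<close>).
  Hence the part of \<open>\<gamma>\<close> up to the parameter \<open>\<tau>\<close> has length \<open>\<tau> t < \<epsilon> p\<close>, and \<open>\<gamma>\<close> does not leave the
  ball of radius \<open>\<epsilon> p\<close> around \<open>p\<close> (\<open>riem_dist_geodesic_le\<close>). Since \<open>\<epsilon> p\<close> is below the geodesic convex
  radius, a geodesic inside this ball is minimal. But the part of \<open>S\<close> in the ball is strongly
  geodesic convex: it contains the only minimal geodesic between the two end points, so it
  contains \<open>\<gamma>\<close>.

  The geodesic \<open>\<gamma>\<close> comes from the definition of the exponential map: membership of \<open>w\<close> in its domain
  says that a geodesic with initial velocity \<open>w\<close> exists, and the chosen value is the end point of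
  such a geodesic.\<close>

section \<open>Charts and auxiliary facts\<close>

lemma chart_inv_left:
  assumes "is_chart c" "p \<in> fst c"
  shows "chart_inv c (snd c p) = p"
  using assms unfolding is_chart_def by (meson homeomorphism_apply1)

lemma open_chart_image:
  assumes "is_chart c" "open V"
  shows "open (snd c ` (fst c \<inter> V))"
proof -
  have hom: "homeomorphism (fst c) (snd c ` fst c) (snd c) (chart_inv c)"
    and op: "open (snd c ` fst c)"
    using assms(1) by (auto simp: is_chart_def)
  have "snd c ` (fst c \<inter> V) = snd c ` fst c \<inter> chart_inv c -` V"
    using hom by (auto simp: homeomorphism_def)
  moreover have "open (snd c ` fst c \<inter> chart_inv c -` V)"
    using hom op assms(2) by (intro continuous_open_preimage) (auto simp: homeomorphism_def)
  ultimately show ?thesis by simp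
qed

lemma matrix_inv_right:
  fixes A :: "real ^ 'k ^ 'k"
  assumes "invertible A"
  shows "A ** matrix_inv A = mat 1"
  using someI_ex[OF assms[unfolded invertible_def]] by (simp add: matrix_inv_def)

lemma linear_functional_expansion:
  fixes L :: "real ^ 'k \<Rightarrow> real"
  assumes "linear L"
  shows "L x = (\<Sum>i\<in>UNIV. x $ i * L (axis i 1))"
proof -
  have "L x = L (\<Sum>i\<in>UNIV. x $ i *s axis i 1)"
    by (simp add: basis_expansion)
  thus ?thesis
    by (simp add: linear_sum[OF assms] scalar_mult_eq_scaleR linear_scale[OF assms])
qed

lemma tuminus_eq_tscale: "tuminus v = tscale (-1) v"
  by (simp add: tuminus_def tscale_def)

lemma eventually_in_open:
  assumes "continuous_on I \<gamma>" "t \<in> I" "\<gamma> t \<in> U" "open U"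
  shows "eventually (\<lambda>s. \<gamma> s \<in> U) (at t within I)"
  using assms by (auto simp: continuous_on_def dest: topological_tendstoD)

context
  fixes M :: "('a::t2_space, 'n::finite) riem_struct"
  assumes M: "riemannian_manifold M"
begin

lemma charts_atD:
  assumes "c \<in> charts_at M p"
  shows "is_chart c" "p \<in> fst c" "c \<in> atlas M"
  using assms M by (auto simp: charts_at_def riemannian_manifold_def smooth_atlas_def)

lemma chart_inv_at:
  assumes "c \<in> charts_at M p"
  shows "chart_inv c (snd c p) = p"
  by (rule chart_inv_left[OF charts_atD(1,2)[OF assms]])

lemma ex_chart_at: "\<exists>c. c \<in> charts_at M p"
proof -
  have "p \<in> (\<Union>c\<in>atlas M. fst c)"
    using M by (simp add: riemannian_manifold_def smooth_atlas_def)
  thus ?thesis by (auto simp: charts_at_def)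
qed

lemma transition_has_derivative:
  assumes "c \<in> charts_at M p" "c' \<in> charts_at M p"
  shows "((snd c' \<circ> chart_inv c) has_derivative
      frechet_derivative (snd c' \<circ> chart_inv c) (at (snd c p))) (at (snd c p))"
proof -
  have "compatible c c'"
    using M charts_atD[OF assms(1)] charts_atD[OF assms(2)]
    by (auto simp: riemannian_manifold_def smooth_atlas_def)
  hence "Ck_on (snd c ` (fst c \<inter> fst c')) (Suc 0) (snd c' \<circ> chart_inv c)"
    unfolding compatible_def smooth_map_on_def by blast
  moreover have "snd c p \<in> snd c ` (fst c \<inter> fst c')"
    using charts_atD(2)[OF assms(1)] charts_atD(2)[OF assms(2)] by auto
  ultimately show ?thesis
    by (auto simp: frechet_derivative_works)
qed

lemma linear_transition:
  assumes "c \<in> charts_at M p" "c' \<in> charts_at M p"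
  shows "linear (frechet_derivative (snd c' \<circ> chart_inv c) (at (snd c p)))"
  using transition_has_derivative[OF assms] has_derivative_linear by blast

text \<open>The chain rule for a change of coordinates. It needs care only because the two coordinate
  expressions of \<open>h\<close> are related by the coordinate change near the point and not everywhere.\<close>

lemma has_derivative_change_chart:
  assumes c: "c \<in> charts_at M p" and c': "c' \<in> charts_at M p"
    and h: "((h \<circ> chart_inv c') has_derivative D) (at (snd c' p))"
  shows "((h \<circ> chart_inv c) has_derivative
      (\<lambda>u. D (frechet_derivative (snd c' \<circ> chart_inv c) (at (snd c p)) u))) (at (snd c p))"
proof -
  have e: "(snd c' \<circ> chart_inv c) (snd c p) = snd c' p"
    using chart_inv_at[OF c] by simp
  have "((h \<circ> chart_inv c') \<circ> (snd c' \<circ> chart_inv c) has_derivative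
     D \<circ> frechet_derivative (snd c' \<circ> chart_inv c) (at (snd c p))) (at (snd c p))"
    by (rule diff_chain_at[OF transition_has_derivative[OF c c']]) (use h e in simp)
  hence "((h \<circ> chart_inv c') \<circ> (snd c' \<circ> chart_inv c) has_derivative
     (\<lambda>u. D (frechet_derivative (snd c' \<circ> chart_inv c) (at (snd c p)) u))) (at (snd c p))"
    by (simp add: o_def)
  moreover have "open (snd c ` (fst c \<inter> fst c'))"
    using open_chart_image charts_atD[OF c] charts_atD[OF c'] is_chart_def by blast
  moreover have "snd c p \<in> snd c ` (fst c \<inter> fst c')"
    using charts_atD(2)[OF c] charts_atD(2)[OF c'] by auto
  moreover have "((h \<circ> chart_inv c') \<circ> (snd c' \<circ> chart_inv c)) x = (h \<circ> chart_inv c) x"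
    if "x \<in> snd c ` (fst c \<inter> fst c')" for x
    using that chart_inv_left[OF charts_atD(1)[OF c]] chart_inv_left[OF charts_atD(1)[OF c']]
    by auto
  ultimately show ?thesis
    by (rule has_derivative_transform_within_open)
qed

text \<open>The chain rule for a function along a curve, computed through a chart.\<close>

lemma has_vector_derivative_along_curve:
  assumes "c \<in> charts_at M (\<gamma> t)" "continuous_on I \<gamma>" "t \<in> I"
    and y: "((snd c \<circ> \<gamma>) has_vector_derivative y) (at t within I)"
    and h: "((h \<circ> chart_inv c) has_derivative D) (at (snd c (\<gamma> t)))"
  shows "((h \<circ> \<gamma>) has_vector_derivative D y) (at t within I)"
proof -
  have 1: "((h \<circ> chart_inv c) \<circ> (snd c \<circ> \<gamma>) has_derivative D \<circ> (\<lambda>x. x *\<^sub>R y)) (at t within I)"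
    using y h unfolding has_vector_derivative_def
    by (intro diff_chain_within) (auto intro: has_derivative_at_withinI)
  have lin: "linear D" using h has_derivative_linear by blast
  have "((h \<circ> chart_inv c) \<circ> (snd c \<circ> \<gamma>) has_vector_derivative D y) (at t within I)"
    using 1 unfolding has_vector_derivative_def by (simp add: o_def linear_scale[OF lin])
  moreover have "eventually (\<lambda>s. \<gamma> s \<in> fst c) (at t within I)"
    using eventually_in_open assms charts_atD[OF assms(1)] is_chart_def by blast
  hence "eventually (\<lambda>s. ((h \<circ> chart_inv c) \<circ> (snd c \<circ> \<gamma>)) s = (h \<circ> \<gamma>) s) (at t within I)"
    by eventually_elim (simp add: chart_inv_left[OF charts_atD(1)[OF assms(1)]])
  moreover have "((h \<circ> chart_inv c) \<circ> (snd c \<circ> \<gamma>)) t = (h \<circ> \<gamma>) t"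
    using chart_inv_at[OF assms(1)] by simp
  ultimately show ?thesis
    using assms(3) unfolding has_vector_derivative_def
    by (rule has_derivative_transform_eventually)
qed

section \<open>The tangent space\<close>

lemma tangent_transition:
  assumes "v \<in> tangent_space M p" "c \<in> charts_at M p" "c' \<in> charts_at M p"
  shows "v c' = frechet_derivative (snd c' \<circ> chart_inv c) (at (snd c p)) (v c)"
  using assms unfolding tangent_space_def by blast

lemma tangent_zero_outside:
  "v \<in> tangent_space M p \<Longrightarrow> c \<notin> charts_at M p \<Longrightarrow> v c = 0"
  unfolding tangent_space_def by blast

lemma tangent_spaceI:
  assumes "\<And>c c'. c \<in> charts_at M p \<Longrightarrow> c' \<in> charts_at M p \<Longrightarrow>
      v c' = frechet_derivative (snd c' \<circ> chart_inv c) (at (snd c p)) (v c)"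
    and "\<And>c. c \<notin> charts_at M p \<Longrightarrow> v c = 0"
  shows "v \<in> tangent_space M p"
  using assms unfolding tangent_space_def by blast

lemma tadd_in_tangent_space:
  assumes "u \<in> tangent_space M p" "v \<in> tangent_space M p"
  shows "tadd u v \<in> tangent_space M p"
proof (rule tangent_spaceI)
  fix c c' assume c: "c \<in> charts_at M p" and c': "c' \<in> charts_at M p"
  show "tadd u v c' = frechet_derivative (snd c' \<circ> chart_inv c) (at (snd c p)) (tadd u v c)"
    unfolding tadd_def linear_add[OF linear_transition[OF c c']]
    using tangent_transition[OF assms(1) c c'] tangent_transition[OF assms(2) c c'] by presburger
qed (simp add: tadd_def assms[THEN tangent_zero_outside])

lemma tscale_in_tangent_space:
  assumes "v \<in> tangent_space M p"
  shows "tscale a v \<in> tangent_space M p"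
proof (rule tangent_spaceI)
  fix c c' assume c: "c \<in> charts_at M p" and c': "c' \<in> charts_at M p"
  show "tscale a v c' = frechet_derivative (snd c' \<circ> chart_inv c) (at (snd c p)) (tscale a v c)"
    unfolding tscale_def linear_scale[OF linear_transition[OF c c']]
    using tangent_transition[OF assms c c'] by presburger
qed (simp add: tscale_def assms[THEN tangent_zero_outside])

text \<open>Tangency of this family is the cocycle identity for the derivatives of the coordinate changes,
  that is, the chain rule for two successive changes.\<close>

lemma coord_vec_in_tangent_space:
  assumes c: "c \<in> charts_at M p"
  shows "coord_vec M c p u \<in> tangent_space M p"
proof -
  have cocycle: "frechet_derivative (snd c'' \<circ> chart_inv c) (at (snd c p)) u =
      frechet_derivative (snd c'' \<circ> chart_inv c') (at (snd c' p))
        (frechet_derivative (snd c' \<circ> chart_inv c) (at (snd c p)) u)"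
    if c': "c' \<in> charts_at M p" and c'': "c'' \<in> charts_at M p" for c' c''
    using has_derivative_unique[OF transition_has_derivative[OF c c'']
        has_derivative_change_chart[OF c c' transition_has_derivative[OF c' c'']]]
    by (rule fun_cong)
  show ?thesis
  proof (rule tangent_spaceI)
    fix c' c'' assume "c' \<in> charts_at M p" "c'' \<in> charts_at M p"
    with cocycle[OF this]
    show "coord_vec M c p u c'' =
        frechet_derivative (snd c'' \<circ> chart_inv c') (at (snd c' p)) (coord_vec M c p u c')"
      unfolding coord_vec_def by presburger
  qed (simp add: coord_vec_def)
qed

lemma coord_vec_same_chart:
  assumes c: "c \<in> charts_at M p"
  shows "coord_vec M c p u c = u"
proof -
  have op: "open (snd c ` (fst c \<inter> UNIV))"
    using open_chart_image charts_atD[OF c] by blast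
  have "((snd c \<circ> chart_inv c) has_derivative (\<lambda>u. u)) (at (snd c p))"
    by (rule has_derivative_transform_within_open[OF has_derivative_ident op])
      (use charts_atD(2)[OF c] chart_inv_left[OF charts_atD(1)[OF c]] in auto)
  from has_derivative_unique[OF this transition_has_derivative[OF c c]]
  have "frechet_derivative (snd c \<circ> chart_inv c) (at (snd c p)) = (\<lambda>u. u)" by simp
  thus ?thesis using c by (simp add: coord_vec_def)
qed

lemma coord_vec_of_coordinates:
  assumes "v \<in> tangent_space M p" "c \<in> charts_at M p"
  shows "coord_vec M c p (v c) = v"
  using tangent_transition[OF assms] tangent_zero_outside[OF assms(1)]
  by (intro ext) (simp add: coord_vec_def)

lemma coord_vec_add:
  "c \<in> charts_at M p \<Longrightarrow> coord_vec M c p (x + y) = tadd (coord_vec M c p x) (coord_vec M c p y)"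
  by (intro ext) (simp add: coord_vec_def tadd_def linear_add[OF linear_transition])

lemma coord_vec_scale:
  "c \<in> charts_at M p \<Longrightarrow> coord_vec M c p (a *\<^sub>R x) = tscale a (coord_vec M c p x)"
  by (intro ext) (simp add: coord_vec_def tscale_def linear_scale[OF linear_transition])

section \<open>The metric in coordinates\<close>

lemma metric_sym:
  "u \<in> tangent_space M p \<Longrightarrow> v \<in> tangent_space M p \<Longrightarrow> metric M p u v = metric M p v u"
  using M unfolding riemannian_manifold_def riemannian_metric_def by blast

lemma metric_add_left:
  "u \<in> tangent_space M p \<Longrightarrow> v \<in> tangent_space M p \<Longrightarrow> w \<in> tangent_space M p \<Longrightarrow>
    metric M p (tadd u v) w = metric M p u w + metric M p v w"
  using M unfolding riemannian_manifold_def riemannian_metric_def by blast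

lemma metric_scale_left:
  "u \<in> tangent_space M p \<Longrightarrow> v \<in> tangent_space M p \<Longrightarrow>
    metric M p (tscale a u) v = a * metric M p u v"
  using M unfolding riemannian_manifold_def riemannian_metric_def by blast

lemma metric_scale_right:
  "u \<in> tangent_space M p \<Longrightarrow> v \<in> tangent_space M p \<Longrightarrow>
    metric M p u (tscale a v) = a * metric M p u v"
  by (metis metric_scale_left metric_sym tscale_in_tangent_space)

lemma metric_add_right:
  "u \<in> tangent_space M p \<Longrightarrow> v \<in> tangent_space M p \<Longrightarrow> w \<in> tangent_space M p \<Longrightarrow>
    metric M p w (tadd u v) = metric M p w u + metric M p w v"
  by (metis metric_add_left metric_sym tadd_in_tangent_space)

lemma metric_pos:
  "v \<in> tangent_space M p \<Longrightarrow> v \<noteq> tzero \<Longrightarrow> metric M p v v > 0"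
  using M unfolding riemannian_manifold_def riemannian_metric_def by blast

lemma metric_tzero_right:
  assumes "v \<in> tangent_space M p"
  shows "metric M p v tzero = 0"
  using metric_scale_right[OF assms assms, of 0] by (simp add: tscale_def tzero_def)

lemma metric_self_nonneg:
  assumes "v \<in> tangent_space M p"
  shows "metric M p v v \<ge> 0"
  using metric_pos[OF assms] metric_tzero_right[OF assms] by (cases "v = tzero") auto

text \<open>Bilinear expansion over the coordinate basis, first in \<open>u\<close> and then in \<open>v\<close>.\<close>

lemma metric_coordinates:
  assumes u: "u \<in> tangent_space M p" and v: "v \<in> tangent_space M p" and c: "c \<in> charts_at M p"
  shows "metric M p u v =
    (\<Sum>i\<in>UNIV. \<Sum>j\<in>UNIV. metric_matrix M c (snd c p) $ i $ j * u c $ i * v c $ j)"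
proof -
  let ?e = "coord_vec M c p"
  note T = coord_vec_in_tangent_space[OF c]
  have "linear (\<lambda>x. metric M p (?e x) v)"
    by (rule linearI)
      (simp_all add: coord_vec_add[OF c] coord_vec_scale[OF c] metric_add_left metric_scale_left T v)
  from linear_functional_expansion[OF this, of "u c"]
  have 1: "metric M p u v = (\<Sum>i\<in>UNIV. u c $ i * metric M p (?e (axis i 1)) v)"
    by (simp add: coord_vec_of_coordinates[OF u c])
  have 2: "metric M p (?e (axis i 1)) v =
      (\<Sum>j\<in>UNIV. v c $ j * metric M p (?e (axis i 1)) (?e (axis j 1)))" for i
  proof -
    have "linear (\<lambda>x. metric M p (?e (axis i 1)) (?e x))"
      by (rule linearI)
        (simp_all add: coord_vec_add[OF c] coord_vec_scale[OF c] metric_add_right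
          metric_scale_right T)
    from linear_functional_expansion[OF this, of "v c"] show ?thesis
      by (simp add: coord_vec_of_coordinates[OF v c])
  qed
  have G: "metric_matrix M c (snd c p) $ i $ j = metric M p (?e (axis i 1)) (?e (axis j 1))" for i j
    by (simp add: metric_matrix_def chart_inv_at[OF c])
  show ?thesis
    unfolding 1 2 G sum_distrib_left by (intro sum.cong refl) (simp only: mult_ac)
qed

lemma metric_matrix_sym:
  assumes c: "c \<in> charts_at M p"
  shows "metric_matrix M c (snd c p) $ i $ j = metric_matrix M c (snd c p) $ j $ i"
  using metric_sym[OF coord_vec_in_tangent_space[OF c] coord_vec_in_tangent_space[OF c],
      of "axis i 1" "axis j 1"]
  by (simp add: metric_matrix_def chart_inv_at[OF c])

text \<open>A vector in the kernel of the Gram matrix would be a nonzero tangent vector of norm \<open>0\<close>.\<close>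

lemma invertible_metric_matrix:
  assumes c: "c \<in> charts_at M p"
  shows "invertible (metric_matrix M c (snd c p))"
proof -
  let ?G = "metric_matrix M c (snd c p)"
  have "x = 0" if x: "?G *v x = 0" for x
  proof (rule ccontr)
    assume "x \<noteq> 0"
    let ?v = "coord_vec M c p x"
    have T: "?v \<in> tangent_space M p" by (rule coord_vec_in_tangent_space[OF c])
    have "?v \<noteq> tzero"
      using \<open>x \<noteq> 0\<close> coord_vec_same_chart[OF c, of x] by (auto simp: tzero_def)
    hence "metric M p ?v ?v > 0" using metric_pos T by blast
    moreover have "metric M p ?v ?v = (\<Sum>i\<in>UNIV. x $ i * (?G *v x) $ i)"
      by (simp add: metric_coordinates[OF T T c] coord_vec_same_chart[OF c]
          matrix_vector_mult_def sum_distrib_left mult_ac)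
    ultimately show False using x by simp
  qed
  hence "\<exists>B. B ** ?G = mat 1" using matrix_left_invertible_ker by blast
  thus ?thesis by (simp add: invertible_left_inverse)
qed

section \<open>The gradient\<close>

text \<open>The description that defines \<^const>\<open>grad\<close> is meaningful. In a chart the gradient solves the
  linear system \<open>G u = df\<close> with the Gram matrix \<open>G\<close>; it is unique because the metric is
  nondegenerate.\<close>

lemma grad_properties:
  assumes f: "differentiable_function M f"
  shows "grad M f p \<in> tangent_space M p \<and>
     (\<forall>v\<in>tangent_space M p. \<forall>c\<in>charts_at M p.
        metric M p (grad M f p) v = frechet_derivative (f \<circ> chart_inv c) (at (snd c p)) (v c))"
proof -
  obtain c where c: "c \<in> charts_at M p" using ex_chart_at by blast
  have df: "((f \<circ> chart_inv c) has_derivative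
      frechet_derivative (f \<circ> chart_inv c) (at (snd c p))) (at (snd c p))"
    if "c \<in> charts_at M p" for c
    using f that by (auto simp: differentiable_function_def frechet_derivative_works)
  define D where "D = frechet_derivative (f \<circ> chart_inv c) (at (snd c p))"
  have linD: "linear D" using df[OF c] has_derivative_linear unfolding D_def by blast
  have same: "frechet_derivative (f \<circ> chart_inv c') (at (snd c' p)) (v c') = D (v c)"
    if v: "v \<in> tangent_space M p" and c': "c' \<in> charts_at M p" for v c'
    using has_derivative_unique[OF df[OF c] has_derivative_change_chart[OF c c' df[OF c']]]
      tangent_transition[OF v c c'] by (simp add: D_def fun_eq_iff)
  \<comment> \<open>The differential of \<open>f\<close> as a column, and the vector with coordinates \<open>G\<inverse> df\<close>.\<close>
  let ?G = "metric_matrix M c (snd c p)"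
  define b where "b = (\<chi> j. D (axis j 1))"
  define u where "u = coord_vec M c p (matrix_inv ?G *v b)"
  have uT: "u \<in> tangent_space M p" unfolding u_def by (rule coord_vec_in_tangent_space[OF c])
  have "?G *v u c = b"
    using matrix_inv_right[OF invertible_metric_matrix[OF c]]
    by (simp add: u_def coord_vec_same_chart[OF c] matrix_vector_mul_assoc)
  hence b: "(\<Sum>i\<in>UNIV. ?G $ j $ i * u c $ i) = D (axis j 1)" for j
    by (simp add: b_def matrix_vector_mult_def vec_eq_iff)
  have u: "metric M p u v = D (v c)" if v: "v \<in> tangent_space M p" for v
  proof -
    have "metric M p u v = metric M p v u" by (rule metric_sym[OF uT v])
    also have "\<dots> = (\<Sum>j\<in>UNIV. v c $ j * (\<Sum>i\<in>UNIV. ?G $ j $ i * u c $ i))"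
      by (simp add: metric_coordinates[OF v uT c] sum_distrib_left mult_ac)
    also have "\<dots> = D (v c)" by (simp add: b linear_functional_expansion[OF linD, of "v c"])
    finally show ?thesis .
  qed
  have "\<exists>!u. u \<in> tangent_space M p \<and> (\<forall>v\<in>tangent_space M p. \<forall>c\<in>charts_at M p.
        metric M p u v = frechet_derivative (f \<circ> chart_inv c) (at (snd c p)) (v c))"
  proof (rule ex1I[of _ u])
    show "u \<in> tangent_space M p \<and> (\<forall>v\<in>tangent_space M p. \<forall>c\<in>charts_at M p.
        metric M p u v = frechet_derivative (f \<circ> chart_inv c) (at (snd c p)) (v c))"
      using uT u same by auto
  next
    fix u'
    assume u': "u' \<in> tangent_space M p \<and> (\<forall>v\<in>tangent_space M p. \<forall>c\<in>charts_at M p.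
        metric M p u' v = frechet_derivative (f \<circ> chart_inv c) (at (snd c p)) (v c))"
    let ?d = "tadd u' (tscale (-1) u)"
    have dT: "?d \<in> tangent_space M p"
      using u' uT tadd_in_tangent_space tscale_in_tangent_space by blast
    have "metric M p ?d ?d = metric M p u' ?d - metric M p u ?d"
      using u' uT dT tscale_in_tangent_space by (simp add: metric_add_left metric_scale_left)
    also have "\<dots> = 0" using u[OF dT] u' dT same[OF dT] c by auto
    finally have "?d = tzero" using metric_pos[OF dT] by fastforce
    thus "u' = u" by (auto simp: tadd_def tscale_def tzero_def fun_eq_iff)
  qed
  thus ?thesis unfolding grad_def by (rule theI')
qed

section \<open>Velocity, length and distance\<close>

lemma velocity_chart_has_vector_derivative:
  assumes "c \<in> charts_at M (\<gamma> t)" "(snd c \<circ> \<gamma>) differentiable (at t within I)"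
  shows "((snd c \<circ> \<gamma>) has_vector_derivative velocity M I \<gamma> t c) (at t within I)"
  using assms by (simp add: velocity_def vector_derivative_works)

text \<open>The interval must be nondegenerate: otherwise derivatives within it are not unique and the
  chosen coordinate velocities in different charts need not be related.\<close>

lemma velocity_in_tangent_space:
  assumes "a < b" "t \<in> {a..b}" "continuous_on {a..b} \<gamma>"
    and diff: "\<And>c. c \<in> charts_at M (\<gamma> t) \<Longrightarrow> (snd c \<circ> \<gamma>) differentiable (at t within {a..b})"
  shows "velocity M {a..b} \<gamma> t \<in> tangent_space M (\<gamma> t)"
proof -
  have "velocity M {a..b} \<gamma> t c' =
      frechet_derivative (snd c' \<circ> chart_inv c) (at (snd c (\<gamma> t))) (velocity M {a..b} \<gamma> t c)"
    if c: "c \<in> charts_at M (\<gamma> t)" and c': "c' \<in> charts_at M (\<gamma> t)" for c c'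
  proof -
    have "((snd c' \<circ> \<gamma>) has_vector_derivative
        frechet_derivative (snd c' \<circ> chart_inv c) (at (snd c (\<gamma> t))) (velocity M {a..b} \<gamma> t c))
        (at t within {a..b})"
      using has_vector_derivative_along_curve[OF c assms(3,2)
          velocity_chart_has_vector_derivative[where \<gamma>=\<gamma>, OF c diff[OF c]]
          transition_has_derivative[OF c c']] .
    moreover have "((snd c' \<circ> \<gamma>) has_vector_derivative velocity M {a..b} \<gamma> t c') (at t within {a..b})"
      by (rule velocity_chart_has_vector_derivative[where \<gamma>=\<gamma>, OF c' diff[OF c']])
    ultimately show ?thesis
      using vector_derivative_unique_within_closed_interval[OF assms(1)] assms(2) by fastforce
  qed
  thus ?thesis by (rule tangent_spaceI) (simp_all add: velocity_def)
qed

text \<open>At a corner of the curve the velocity is an arbitrary value, which may fail to be tangent, and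
  the square root of a negative real is negative. So the integrand is changed to \<open>0\<close> at the
  finitely many nodes of the subdivision before its sign is used. If it is not integrable, its
  integral is \<open>0\<close> by convention.\<close>

lemma curve_length_nonneg:
  assumes "piecewise_C1_curve M \<gamma>"
  shows "curve_length M \<gamma> \<ge> 0"
proof -
  obtain D where D: "finite D" "{0, 1} \<subseteq> D" "D \<subseteq> {0..1}"
    and C1: "\<forall>a\<in>D. \<forall>b\<in>D. a < b \<and> {a<..<b} \<inter> D = {} \<longrightarrow> C1_curve_on M {a..b} \<gamma>"
    using assms unfolding piecewise_C1_curve_def by (elim exE conjE)
  let ?F = "\<lambda>t. tnorm M (\<gamma> t) (velocity M {0..1} \<gamma> t)"
  have nonneg: "?F t \<ge> 0" if t: "t \<in> {0..1} - D" for t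
  proof -
    \<comment> \<open>The nodes next to \<open>t\<close> on either side.\<close>
    define a where "a = Max {d\<in>D. d < t}"
    define b where "b = Min {d\<in>D. t < d}"
    have "0 \<in> {d\<in>D. d < t}" "1 \<in> {d\<in>D. t < d}"
      using t D(2) by (auto simp: less_le)
    moreover have fin: "finite {d\<in>D. d < t}" "finite {d\<in>D. t < d}" using D(1) by auto
    ultimately have "a \<in> {d\<in>D. d < t}" "b \<in> {d\<in>D. t < d}"
      unfolding a_def b_def using Max_in Min_in by blast+
    hence ab: "a \<in> D" "a < t" "b \<in> D" "t < b" by auto
    have "d \<le> a \<or> b \<le> d" if "d \<in> D" for d
    proof -
      have "d < t \<or> t < d" using that t by (metis DiffD2 linorder_neqE)
      thus ?thesis unfolding a_def b_def using fin that Max_ge Min_le by blast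
    qed
    hence "{a<..<b} \<inter> D = {}" by force
    with C1 ab have c1: "C1_curve_on M {a..b} \<gamma>" by simp
    have "velocity M {a..b} \<gamma> t \<in> tangent_space M (\<gamma> t)"
      by (rule velocity_in_tangent_space)
        (use c1 ab in \<open>auto simp: C1_curve_on_def charts_at_def\<close>)
    moreover have "velocity M {a..b} \<gamma> t = velocity M {0..1} \<gamma> t"
    proof -
      have "at t within {a..b} = at t"
        using ab by (intro at_within_interior) (simp add: interior_atLeastAtMost_real)
      moreover have "at t within {0..1} = at t"
        using ab D(3) by (intro at_within_interior) (auto simp: interior_atLeastAtMost_real)
      ultimately show ?thesis unfolding velocity_def by presburger
    qed
    ultimately show ?thesis
      using metric_self_nonneg by (simp add: tnorm_def)
  qed
  let ?H = "\<lambda>t. if t \<in> D then 0 else ?F t"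
  have "integral {0..1} ?F = integral {0..1} ?H"
    by (rule integral_spike[OF negligible_finite[OF D(1)]]) auto
  moreover have "integral {0..1} ?H \<ge> 0"
  proof (cases "?H integrable_on {0..1}")
    case True
    thus ?thesis using nonneg by (intro integral_nonneg) auto
  next
    case False
    thus ?thesis by (simp add: not_integrable_integral)
  qed
  ultimately show ?thesis by (simp add: curve_length_def)
qed

text \<open>The infimum is a lower bound only because the lengths are bounded below.\<close>

lemma riem_dist_le_curve_length:
  assumes "piecewise_C1_curve M \<gamma>"
  shows "riem_dist M (\<gamma> 0) (\<gamma> 1) \<le> curve_length M \<gamma>"
  unfolding riem_dist_def
proof (rule cInf_lower)
  show "bdd_below {curve_length M \<sigma> | \<sigma>. piecewise_C1_curve M \<sigma> \<and> \<sigma> 0 = \<gamma> 0 \<and> \<sigma> 1 = \<gamma> 1}"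
    by (rule bdd_belowI[of _ 0]) (use curve_length_nonneg in blast)
qed (use assms in blast)

section \<open>Geodesics have constant speed\<close>

lemma geodesic_chartD:
  assumes "geodesic M \<gamma>" "t \<in> {0..1}" "c \<in> charts_at M (\<gamma> t)"
  shows "(snd c \<circ> \<gamma>) differentiable (at t within {0..1})"
    and "((\<lambda>s. velocity M {0..1} \<gamma> s c) has_vector_derivative
           (\<chi> k. - (\<Sum>i\<in>UNIV. \<Sum>j\<in>UNIV. christoffel M c (snd c (\<gamma> t)) k i j *
                      velocity M {0..1} \<gamma> t c $ i * velocity M {0..1} \<gamma> t c $ j)))
          (at t within {0..1})"
  using assms by (auto simp: geodesic_def charts_at_def)

lemma geodesic_velocity_in_tangent_space:
  assumes "geodesic M \<gamma>" "t \<in> {0..1}"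
  shows "velocity M {0..1} \<gamma> t \<in> tangent_space M (\<gamma> t)"
  by (rule velocity_in_tangent_space)
    (use assms geodesic_chartD in \<open>auto simp: geodesic_def\<close>)

end

text \<open>The algebra behind conservation of speed, at one point of a chart: \<open>g\<close> is the Gram matrix with
  inverse \<open>H\<close>, \<open>dg l\<close> its derivative in direction \<open>l\<close>, \<open>G\<close> the Christoffel symbols, \<open>y\<close> the velocity
  and \<open>z\<close> the acceleration. Lowering the index of \<open>G\<close> cancels \<open>H\<close>. Contracted with three copies of
  \<open>y\<close>, the three derivative terms of the lowered symbol become equal up to sign, to \<open>T\<close>, \<open>T\<close> and
  \<open>- T\<close>. So each of the two terms with \<open>z\<close> equals \<open>- T / 2\<close>, and together they cancel the
  term \<open>T\<close> that comes from differentiating \<open>g\<close>.\<close>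

lemma christoffel_cancellation:
  fixes g H :: "'k::finite \<Rightarrow> 'k \<Rightarrow> real" and dg G :: "'k \<Rightarrow> 'k \<Rightarrow> 'k \<Rightarrow> real" and y z :: "'k \<Rightarrow> real"
  assumes sym: "\<And>i j. g i j = g j i"
    and inv: "\<And>a l. (\<Sum>k\<in>UNIV. g a k * H k l) = (if a = l then 1 else 0)"
    and G: "\<And>k i j. G k i j = (1/2) * (\<Sum>l\<in>UNIV. H k l * (dg i j l + dg j i l - dg l i j))"
    and z: "\<And>k. z k = - (\<Sum>i\<in>UNIV. \<Sum>j\<in>UNIV. G k i j * y i * y j)"
  shows "(\<Sum>i\<in>UNIV. \<Sum>j\<in>UNIV. (\<Sum>l\<in>UNIV. y l * dg l i j) * y i * y j
            + g i j * z i * y j + g i j * y i * z j) = 0"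
proof -
  define T where "T = (\<Sum>a\<in>UNIV. \<Sum>i\<in>UNIV. \<Sum>j\<in>UNIV. dg a i j * y a * y i * y j)"
  have lower: "(\<Sum>k\<in>UNIV. g a k * G k i j) = (dg i j a + dg j i a - dg a i j) / 2" for a i j
  proof -
    have "(\<Sum>k\<in>UNIV. g a k * G k i j) =
        (\<Sum>k\<in>UNIV. \<Sum>l\<in>UNIV. (1/2) * (dg i j l + dg j i l - dg l i j) * (g a k * H k l))"
      by (simp add: G sum_distrib_left mult_ac)
    also have "\<dots> = (\<Sum>l\<in>UNIV. (1/2) * (dg i j l + dg j i l - dg l i j) * (\<Sum>k\<in>UNIV. g a k * H k l))"
      by (subst sum.swap) (simp add: sum_distrib_left)
    also have "\<dots> = (dg i j a + dg j i a - dg a i j) / 2"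
      by (simp add: inv if_distrib cong: if_cong)
    finally show ?thesis .
  qed
  have gz: "(\<Sum>k\<in>UNIV. g a k * z k) =
      - (\<Sum>i\<in>UNIV. \<Sum>j\<in>UNIV. (dg i j a + dg j i a - dg a i j) / 2 * y i * y j)" for a
  proof -
    have "(\<Sum>k\<in>UNIV. g a k * z k) = - (\<Sum>k\<in>UNIV. \<Sum>i\<in>UNIV. \<Sum>j\<in>UNIV. (g a k * G k i j) * (y i * y j))"
      by (simp add: z sum_distrib_left sum_negf mult_ac)
    also have "(\<Sum>k\<in>UNIV. \<Sum>i\<in>UNIV. \<Sum>j\<in>UNIV. (g a k * G k i j) * (y i * y j)) =
        (\<Sum>i\<in>UNIV. \<Sum>k\<in>UNIV. \<Sum>j\<in>UNIV. (g a k * G k i j) * (y i * y j))"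
      by (rule sum.swap)
    also have "\<dots> = (\<Sum>i\<in>UNIV. \<Sum>j\<in>UNIV. \<Sum>k\<in>UNIV. (g a k * G k i j) * (y i * y j))"
      by (rule sum.cong[OF refl]) (rule sum.swap)
    also have "\<dots> = (\<Sum>i\<in>UNIV. \<Sum>j\<in>UNIV. (dg i j a + dg j i a - dg a i j) / 2 * (y i * y j))"
      by (simp only: sum_distrib_right[symmetric] lower)
    finally show ?thesis by (simp add: mult_ac)
  qed
  have T1: "(\<Sum>a\<in>UNIV. \<Sum>i\<in>UNIV. \<Sum>j\<in>UNIV. dg i j a * y a * y i * y j) = T"
  proof -
    have "(\<Sum>a\<in>UNIV. \<Sum>i\<in>UNIV. \<Sum>j\<in>UNIV. dg i j a * y a * y i * y j)
        = (\<Sum>i\<in>UNIV. \<Sum>a\<in>UNIV. \<Sum>j\<in>UNIV. dg i j a * y a * y i * y j)"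
      by (rule sum.swap)
    also have "\<dots> = (\<Sum>i\<in>UNIV. \<Sum>j\<in>UNIV. \<Sum>a\<in>UNIV. dg i j a * y a * y i * y j)"
      by (rule sum.cong[OF refl]) (rule sum.swap)
    finally show ?thesis by (simp add: T_def mult_ac)
  qed
  have T2: "(\<Sum>a\<in>UNIV. \<Sum>i\<in>UNIV. \<Sum>j\<in>UNIV. dg j i a * y a * y i * y j) = T"
  proof -
    have "(\<Sum>a\<in>UNIV. \<Sum>i\<in>UNIV. \<Sum>j\<in>UNIV. dg j i a * y a * y i * y j)
        = (\<Sum>a\<in>UNIV. \<Sum>j\<in>UNIV. \<Sum>i\<in>UNIV. dg j i a * y a * y i * y j)"
      by (rule sum.cong[OF refl]) (rule sum.swap)
    also have "\<dots> = T" using T1 by (simp add: mult_ac)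
    finally show ?thesis .
  qed
  have lowered: "y a * (\<Sum>k\<in>UNIV. g a k * z k) = - (\<Sum>i\<in>UNIV. \<Sum>j\<in>UNIV.
      dg i j a * y a * y i * y j / 2 + dg j i a * y a * y i * y j / 2
        - dg a i j * y a * y i * y j / 2)" for a
    unfolding gz mult_minus_right sum_distrib_left
    by (rule arg_cong[where f=uminus], rule sum.cong[OF refl], rule sum.cong[OF refl])
      (simp add: field_simps)
  have half: "(\<Sum>i\<in>UNIV. \<Sum>j\<in>UNIV. g i j * y i * z j) = - T / 2"
  proof -
    have "(\<Sum>i\<in>UNIV. \<Sum>j\<in>UNIV. g i j * y i * z j) = (\<Sum>a\<in>UNIV. y a * (\<Sum>k\<in>UNIV. g a k * z k))"
      by (simp only: sum_distrib_left mult_ac)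
    also have "\<dots> = - (T / 2 + T / 2 - T / 2)"
      unfolding lowered sum_negf
      by (simp only: sum.distrib sum_subtractf sum_divide_distrib[symmetric] T1 T2 T_def[symmetric])
    finally show ?thesis by simp
  qed
  have half': "(\<Sum>i\<in>UNIV. \<Sum>j\<in>UNIV. g i j * z i * y j) = - T / 2"
  proof -
    have "(\<Sum>i\<in>UNIV. \<Sum>j\<in>UNIV. g i j * z i * y j) = (\<Sum>j\<in>UNIV. \<Sum>i\<in>UNIV. g j i * y j * z i)"
      by (subst sum.swap) (simp add: sym mult_ac)
    thus ?thesis using half by simp
  qed
  have "(\<Sum>i\<in>UNIV. \<Sum>j\<in>UNIV. (\<Sum>l\<in>UNIV. y l * dg l i j) * y i * y j) =
      (\<Sum>i\<in>UNIV. \<Sum>j\<in>UNIV. \<Sum>l\<in>UNIV. dg l i j * y l * y i * y j)"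
    by (simp only: sum_distrib_left mult_ac)
  also have "\<dots> = (\<Sum>i\<in>UNIV. \<Sum>l\<in>UNIV. \<Sum>j\<in>UNIV. dg l i j * y l * y i * y j)"
    by (rule sum.cong[OF refl]) (rule sum.swap)
  also have "\<dots> = T" unfolding T_def by (rule sum.swap)
  finally show ?thesis by (simp add: sum.distrib half half')
qed

context
  fixes M :: "('a::t2_space, 'n::finite) riem_struct"
  assumes M: "riemannian_manifold M"
begin

text \<open>Near \<open>t\<close> the geodesic runs in a single chart, where the squared speed is
  \<open>\<Sum>i j. g i j (x s) * y s $ i * y s $ j\<close>; its derivative is the expression treated above.\<close>

lemma geodesic_energy_derivative:
  assumes \<gamma>: "geodesic M \<gamma>" and t: "t \<in> {0..1}"
  shows "((\<lambda>s. metric M (\<gamma> s) (velocity M {0..1} \<gamma> s) (velocity M {0..1} \<gamma> s))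
    has_vector_derivative 0) (at t within {0..1})"
proof -
  obtain c where c: "c \<in> charts_at M (\<gamma> t)" using ex_chart_at[OF M] by blast
  define x where "x s = snd c (\<gamma> s)" for s
  define y where "y s = velocity M {0..1} \<gamma> s c" for s
  define g where "g i j X = metric_matrix M c X $ i $ j" for i j X
  define dg where "dg l i j = frechet_derivative (g i j) (at (x t)) (axis l 1)" for l i j
  define z :: "real ^ 'n" where "z = (\<chi> k. - (\<Sum>i\<in>UNIV. \<Sum>j\<in>UNIV.
      christoffel M c (x t) k i j * y t $ i * y t $ j))"
  have x': "(x has_vector_derivative y t) (at t within {0..1})"
    using velocity_chart_has_vector_derivative[OF M, where \<gamma>=\<gamma>, OF c geodesic_chartD(1)[OF M \<gamma> t c]]
    by (simp add: x_def[abs_def] y_def o_def)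
  have y': "(y has_vector_derivative z) (at t within {0..1})"
    using geodesic_chartD(2)[OF M \<gamma> t c] by (simp add: x_def y_def[abs_def] z_def)
  have y'_comp: "((\<lambda>s. y s $ i) has_vector_derivative z $ i) (at t within {0..1})" for i
    by (rule bounded_linear.has_vector_derivative[OF bounded_linear_vec_nth y'])
  have g': "((\<lambda>s. g i j (x s)) has_vector_derivative (\<Sum>l\<in>UNIV. y t $ l * dg l i j))
      (at t within {0..1})" for i j
  proof -
    have "smooth_map_on (snd c ` fst c) (g i j)"
      using M charts_atD(3)[OF M c]
      unfolding riemannian_manifold_def riemannian_metric_def g_def[abs_def] by blast
    hence "Ck_on (snd c ` fst c) (Suc 0) (g i j)" unfolding smooth_map_on_def by blast
    hence d: "(g i j has_derivative frechet_derivative (g i j) (at (x t))) (at (x t))"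
      using charts_atD(2)[OF M c] by (simp add: frechet_derivative_works x_def)
    hence lin: "linear (frechet_derivative (g i j) (at (x t)))"
      using has_derivative_linear by blast
    have "((g i j \<circ> x) has_derivative frechet_derivative (g i j) (at (x t)) \<circ> (\<lambda>h. h *\<^sub>R y t))
        (at t within {0..1})"
      using x' d unfolding has_vector_derivative_def
      by (intro diff_chain_within) (auto intro: has_derivative_at_withinI)
    hence "((g i j \<circ> x) has_vector_derivative frechet_derivative (g i j) (at (x t)) (y t))
        (at t within {0..1})"
      by (simp add: has_vector_derivative_def o_def linear_scale[OF lin])
    thus ?thesis
      by (simp add: o_def dg_def linear_functional_expansion[OF lin, of "y t"])
  qed
  have "((\<lambda>s. \<Sum>i\<in>UNIV. \<Sum>j\<in>UNIV. g i j (x s) * y s $ i * y s $ j) has_vector_derivative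
     (\<Sum>i\<in>UNIV. \<Sum>j\<in>UNIV. (\<Sum>l\<in>UNIV. y t $ l * dg l i j) * y t $ i * y t $ j
            + g i j (x t) * z $ i * y t $ j + g i j (x t) * y t $ i * z $ j)) (at t within {0..1})"
  proof (intro has_vector_derivative_sum)
    fix i j
    show "((\<lambda>s. g i j (x s) * y s $ i * y s $ j) has_vector_derivative
      (\<Sum>l\<in>UNIV. y t $ l * dg l i j) * y t $ i * y t $ j
            + g i j (x t) * z $ i * y t $ j + g i j (x t) * y t $ i * z $ j) (at t within {0..1})"
      using has_vector_derivative_mult[OF has_vector_derivative_mult[OF g'[of i j] y'_comp[of i]]
          y'_comp[of j]]
      by (simp add: algebra_simps)
  qed
  moreover have "(\<Sum>i\<in>UNIV. \<Sum>j\<in>UNIV. (\<Sum>l\<in>UNIV. y t $ l * dg l i j) * y t $ i * y t $ j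
            + g i j (x t) * z $ i * y t $ j + g i j (x t) * y t $ i * z $ j) = 0"
  proof (rule christoffel_cancellation)
    show "g i j (x t) = g j i (x t)" for i j
      unfolding g_def x_def by (rule metric_matrix_sym[OF M c])
    show "(\<Sum>k\<in>UNIV. g a k (x t) * matrix_inv (metric_matrix M c (x t)) $ k $ l) =
        (if a = l then 1 else 0)" for a l
      using matrix_inv_right[OF invertible_metric_matrix[OF M c]]
      by (simp add: x_def g_def matrix_matrix_mult_def mat_def vec_eq_iff)
    show "christoffel M c (x t) k i j = (1/2) * (\<Sum>l\<in>UNIV.
        matrix_inv (metric_matrix M c (x t)) $ k $ l * (dg i j l + dg j i l - dg l i j))" for k i j
      by (simp add: christoffel_def dg_def g_def[abs_def])
    show "z $ k = - (\<Sum>i\<in>UNIV. \<Sum>j\<in>UNIV. christoffel M c (x t) k i j * y t $ i * y t $ j)" for k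
      by (simp add: z_def)
  qed
  ultimately have E: "((\<lambda>s. \<Sum>i\<in>UNIV. \<Sum>j\<in>UNIV. g i j (x s) * y s $ i * y s $ j)
      has_vector_derivative 0) (at t within {0..1})"
    by simp
  have eq: "(\<Sum>i\<in>UNIV. \<Sum>j\<in>UNIV. g i j (x s) * y s $ i * y s $ j) =
      metric M (\<gamma> s) (velocity M {0..1} \<gamma> s) (velocity M {0..1} \<gamma> s)"
    if "s \<in> {0..1}" "\<gamma> s \<in> fst c" for s
  proof -
    have cs: "c \<in> charts_at M (\<gamma> s)"
      using that(2) charts_atD(3)[OF M c] by (simp add: charts_at_def)
    have v: "velocity M {0..1} \<gamma> s \<in> tangent_space M (\<gamma> s)"
      by (rule geodesic_velocity_in_tangent_space[OF M \<gamma> that(1)])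
    show ?thesis
      unfolding metric_coordinates[OF M v v cs] x_def y_def g_def ..
  qed
  have "eventually (\<lambda>s. \<gamma> s \<in> fst c) (at t within {0..1})"
    by (rule eventually_in_open[OF _ t])
      (use \<gamma> charts_atD[OF M c] in \<open>auto simp: is_chart_def geodesic_def\<close>)
  moreover have "eventually (\<lambda>s. s \<in> {0..1}) (at t within {0..1})"
    by (simp add: eventually_at_filter)
  ultimately have "eventually (\<lambda>s. (\<Sum>i\<in>UNIV. \<Sum>j\<in>UNIV. g i j (x s) * y s $ i * y s $ j) =
      metric M (\<gamma> s) (velocity M {0..1} \<gamma> s) (velocity M {0..1} \<gamma> s)) (at t within {0..1})"
    by eventually_elim (rule eq)
  from has_derivative_transform_eventually[OF E[unfolded has_vector_derivative_def] this]
  show ?thesis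
    using eq[OF t] charts_atD[OF M c] t unfolding has_vector_derivative_def by simp
qed

lemma geodesic_constant_speed:
  assumes \<gamma>: "geodesic M \<gamma>" and t: "t \<in> {0..1}"
  shows "tnorm M (\<gamma> t) (velocity M {0..1} \<gamma> t) = tnorm M (\<gamma> 0) (velocity M {0..1} \<gamma> 0)"
proof -
  obtain k where "\<And>t. t \<in> {0..1} \<Longrightarrow>
      metric M (\<gamma> t) (velocity M {0..1} \<gamma> t) (velocity M {0..1} \<gamma> t) = k"
    using has_vector_derivative_zero_constant[OF convex_real_interval(5)
        geodesic_energy_derivative[OF \<gamma>]] by blast
  thus ?thesis using t by (simp add: tnorm_def)
qed

text \<open>The curve \<open>s \<mapsto> \<gamma> (\<tau> s)\<close> runs through the part of \<open>\<gamma>\<close> up to \<open>\<tau>\<close>, on the unit interval that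
  the definition of length refers to. For \<open>\<tau> = 0\<close> it is constant.\<close>

lemma initial_segment_velocity:
  assumes \<gamma>: "geodesic M \<gamma>" and \<tau>: "\<tau> \<in> {0..1}" and s: "s \<in> {0..1}"
    and c: "c \<in> charts_at M (\<gamma> (\<tau> * s))"
  shows "((snd c \<circ> (\<lambda>s. \<gamma> (\<tau> * s))) has_vector_derivative
      \<tau> *\<^sub>R velocity M {0..1} \<gamma> (\<tau> * s) c) (at s within {0..1})"
    and "velocity M {0..1} (\<lambda>s. \<gamma> (\<tau> * s)) s c = \<tau> *\<^sub>R velocity M {0..1} \<gamma> (\<tau> * s) c"
proof -
  have ts: "\<tau> * s \<in> {0..1}" using \<tau> s by (auto intro: mult_le_one)
  have "(*) \<tau> ` {0..1} \<subseteq> {0..1}" using \<tau> by (auto intro: mult_le_one)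
  hence "((snd c \<circ> \<gamma>) has_vector_derivative velocity M {0..1} \<gamma> (\<tau> * s) c)
      (at (\<tau> * s) within (*) \<tau> ` {0..1})"
    using velocity_chart_has_vector_derivative[OF M, where \<gamma>=\<gamma>, OF c geodesic_chartD(1)[OF M \<gamma> ts c]]
      has_vector_derivative_within_subset by blast
  moreover have "((*) \<tau> has_vector_derivative \<tau>) (at s within {0..1})"
    by (auto intro!: derivative_eq_intros)
  ultimately show 1: "((snd c \<circ> (\<lambda>s. \<gamma> (\<tau> * s))) has_vector_derivative
      \<tau> *\<^sub>R velocity M {0..1} \<gamma> (\<tau> * s) c) (at s within {0..1})"
    using vector_diff_chain_within[of "(*) \<tau>" \<tau> s "{0..1}" "snd c \<circ> \<gamma>"] by (simp add: o_def)
  show "velocity M {0..1} (\<lambda>s. \<gamma> (\<tau> * s)) s c = \<tau> *\<^sub>R velocity M {0..1} \<gamma> (\<tau> * s) c"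
    using c vector_derivative_within_cbox[OF _ _ 1[folded box_real]] s by (simp add: velocity_def)
qed

text \<open>By constancy of speed, the right-hand side is the length of the part of \<open>\<gamma>\<close> up to \<open>\<tau>\<close>.\<close>

lemma riem_dist_geodesic_le:
  assumes \<gamma>: "geodesic M \<gamma>" and \<tau>: "\<tau> \<in> {0..1}"
  shows "riem_dist M (\<gamma> 0) (\<gamma> \<tau>) \<le> \<tau> * tnorm M (\<gamma> 0) (velocity M {0..1} \<gamma> 0)"
proof -
  let ?\<sigma> = "\<lambda>s. \<gamma> (\<tau> * s)"
  have sub: "\<tau> * s \<in> {0..1}" if "s \<in> {0..1}" for s
    using \<tau> that by (auto intro: mult_le_one)
  have cont\<gamma>: "continuous_on {0..1} \<gamma>" using \<gamma> by (simp add: geodesic_def)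
  have cont: "continuous_on {0..1} ?\<sigma>"
    by (rule continuous_on_compose2[OF cont\<gamma>]) (use sub in \<open>auto intro!: continuous_intros\<close>)
  have "C1_curve_on M {0..1} ?\<sigma>"
    unfolding C1_curve_on_def
  proof (intro conjI ballI impI cont)
    fix c s assume "c \<in> atlas M" "s \<in> {0..1}" "?\<sigma> s \<in> fst c"
    hence "c \<in> charts_at M (?\<sigma> s)" by (simp add: charts_at_def)
    from initial_segment_velocity(1)[OF \<gamma> \<tau> \<open>s \<in> _\<close> this]
    show "(snd c \<circ> ?\<sigma>) differentiable (at s within {0..1})"
      using differentiableI_vector by blast
  next
    fix c assume c: "c \<in> atlas M"
    have "continuous_on {t \<in> {0..1}. \<gamma> t \<in> fst c} (\<lambda>t. velocity M {0..1} \<gamma> t c)"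
    proof (intro continuous_on_eq_continuous_within[THEN iffD2] ballI)
      fix t assume t: "t \<in> {t \<in> {0..1}. \<gamma> t \<in> fst c}"
      hence "c \<in> charts_at M (\<gamma> t)" using c by (simp add: charts_at_def)
      with geodesic_chartD(2)[OF M \<gamma>] t
      have "continuous (at t within {0..1}) (\<lambda>t. velocity M {0..1} \<gamma> t c)"
        using has_vector_derivative_continuous by blast
      thus "continuous (at t within {t \<in> {0..1}. \<gamma> t \<in> fst c}) (\<lambda>t. velocity M {0..1} \<gamma> t c)"
        by (rule continuous_within_subset) auto
    qed
    moreover have "continuous_on {s \<in> {0..1}. ?\<sigma> s \<in> fst c} (\<lambda>s. \<tau> * s)"
      by (intro continuous_intros)
    moreover have "(\<lambda>s. \<tau> * s) ` {s \<in> {0..1}. ?\<sigma> s \<in> fst c} \<subseteq> {t \<in> {0..1}. \<gamma> t \<in> fst c}"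
      using sub by blast
    ultimately have
      "continuous_on {s \<in> {0..1}. ?\<sigma> s \<in> fst c} (\<lambda>s. velocity M {0..1} \<gamma> (\<tau> * s) c)"
      by (rule continuous_on_compose2)
    hence "continuous_on {s \<in> {0..1}. ?\<sigma> s \<in> fst c} (\<lambda>s. \<tau> *\<^sub>R velocity M {0..1} \<gamma> (\<tau> * s) c)"
      by (intro continuous_intros)
    moreover have eq: "velocity M {0..1} ?\<sigma> s c = \<tau> *\<^sub>R velocity M {0..1} \<gamma> (\<tau> * s) c"
      if "s \<in> {s \<in> {0..1}. ?\<sigma> s \<in> fst c}" for s
      using initial_segment_velocity(2)[OF \<gamma> \<tau>, of s c] that c by (simp add: charts_at_def)
    ultimately show "continuous_on {s \<in> {0..1}. ?\<sigma> s \<in> fst c} (\<lambda>s. velocity M {0..1} ?\<sigma> s c)"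
      by (simp only: continuous_on_cong[OF refl eq])
  qed
  hence "piecewise_C1_curve M ?\<sigma>"
    unfolding piecewise_C1_curve_def by (intro exI[of _ "{0, 1}"]) simp
  hence "riem_dist M (\<gamma> 0) (\<gamma> \<tau>) \<le> curve_length M ?\<sigma>"
    using riem_dist_le_curve_length[OF M, of ?\<sigma>] by simp
  also have "curve_length M ?\<sigma> = integral {0..1} (\<lambda>s::real. \<tau> * tnorm M (\<gamma> 0) (velocity M {0..1} \<gamma> 0))"
    unfolding curve_length_def
  proof (rule integral_cong)
    fix s :: real assume s: "s \<in> {0..1}"
    have v: "velocity M {0..1} ?\<sigma> s = tscale \<tau> (velocity M {0..1} \<gamma> (\<tau> * s))"
    proof
      fix c
      show "velocity M {0..1} ?\<sigma> s c = tscale \<tau> (velocity M {0..1} \<gamma> (\<tau> * s)) c"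
      proof (cases "c \<in> charts_at M (\<gamma> (\<tau> * s))")
        case True
        thus ?thesis using initial_segment_velocity(2)[OF \<gamma> \<tau> s] by (simp add: tscale_def)
      next
        case False
        thus ?thesis by (simp add: velocity_def tscale_def)
      qed
    qed
    have T: "velocity M {0..1} \<gamma> (\<tau> * s) \<in> tangent_space M (\<gamma> (\<tau> * s))"
      by (rule geodesic_velocity_in_tangent_space[OF M \<gamma> sub[OF s]])
    have "tnorm M (\<gamma> (\<tau> * s)) (tscale \<tau> (velocity M {0..1} \<gamma> (\<tau> * s))) =
        \<tau> * tnorm M (\<gamma> (\<tau> * s)) (velocity M {0..1} \<gamma> (\<tau> * s))"
      using \<tau> T tscale_in_tangent_space[OF M T]
      by (simp add: tnorm_def metric_scale_left[OF M] metric_scale_right[OF M] real_sqrt_mult)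
    thus "tnorm M (?\<sigma> s) (velocity M {0..1} ?\<sigma> s) = \<tau> * tnorm M (\<gamma> 0) (velocity M {0..1} \<gamma> 0)"
      by (simp add: v geodesic_constant_speed[OF \<gamma> sub[OF s]])
  qed
  also have "\<dots> = \<tau> * tnorm M (\<gamma> 0) (velocity M {0..1} \<gamma> 0)" by simp
  finally show ?thesis .
qed

section \<open>Short geodesics between points of a locally convex set, and first order optimality\<close>

text \<open>The ball contains \<open>\<gamma>\<close> by the distance estimate, hence \<open>\<gamma>\<close> is minimal, hence it is the minimal
  geodesic that strong convexity of the part of \<open>S\<close> in the ball provides.\<close>

lemma short_geodesic_subset:
  assumes \<epsilon>: "local_convexity_radii M S \<epsilon>" and \<gamma>: "geodesic M \<gamma>"
    and ends: "\<gamma> 0 \<in> S" "\<gamma> 1 \<in> S"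
    and short: "tnorm M (\<gamma> 0) (velocity M {0..1} \<gamma> 0) < \<epsilon> (\<gamma> 0)"
  shows "\<gamma> ` {0..1} \<subseteq> S"
proof -
  let ?p = "\<gamma> 0" and ?B = "riem_ball M (\<gamma> 0) (\<epsilon> (\<gamma> 0))"
  have "?p \<in> closure S" using ends(1) closure_subset by blast
  with \<epsilon> have pos: "0 < \<epsilon> ?p" and rad: "ereal (\<epsilon> ?p) < geodesic_convex_radius M ?p"
    and conv: "strongly_geodesic_convex M (S \<inter> ?B)"
    by (auto simp: local_convexity_radii_def)
  have nn: "0 \<le> tnorm M ?p (velocity M {0..1} \<gamma> 0)"
    using metric_self_nonneg[OF M geodesic_velocity_in_tangent_space[OF M \<gamma>, of 0]]
    by (simp add: tnorm_def)
  have inB: "\<gamma> ` {0..1} \<subseteq> ?B"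
  proof (clarsimp simp: riem_ball_def)
    fix \<tau> :: real assume "0 \<le> \<tau>" "\<tau> \<le> 1"
    hence "riem_dist M ?p (\<gamma> \<tau>) \<le> 1 * tnorm M ?p (velocity M {0..1} \<gamma> 0)"
      using riem_dist_geodesic_le[OF \<gamma>, of \<tau>] mult_right_mono[OF _ nn, of \<tau> 1] by force
    with short show "riem_dist M ?p (\<gamma> \<tau>) < \<epsilon> ?p" by simp
  qed
  have "minimal_geodesic M (\<gamma> 0) (\<gamma> 1) \<gamma>"
    using rad pos \<gamma> inB unfolding geodesic_convex_radius_def less_Sup_iff by auto
  moreover have "\<gamma> 0 \<in> S \<inter> ?B" "\<gamma> 1 \<in> S \<inter> ?B" using ends inB by auto
  then obtain \<sigma> where "\<sigma> ` {0..1} \<subseteq> S \<inter> ?B"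
    and "\<forall>\<gamma>'. minimal_geodesic M (\<gamma> 0) (\<gamma> 1) \<gamma>' \<longrightarrow> (\<forall>t\<in>{0..1}. \<gamma>' t = \<sigma> t)"
    using conv unfolding strongly_geodesic_convex_def by blast
  ultimately show ?thesis by fastforce
qed

text \<open>The difference quotients of \<open>f \<circ> \<gamma>\<close> at \<open>0\<close> from the right are eventually nonnegative, and they
  converge to the differential of \<open>f\<close> applied to the initial velocity.\<close>

lemma grad_along_geodesic_nonneg:
  assumes f: "differentiable_function M f" and opt: "local_optimal_solution f S (\<gamma> 0)"
    and \<gamma>: "geodesic M \<gamma>" and sub: "\<gamma> ` {0..1} \<subseteq> S"
  shows "metric M (\<gamma> 0) (grad M f (\<gamma> 0)) (velocity M {0..1} \<gamma> 0) \<ge> 0"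
proof -
  let ?w = "velocity M {0..1} \<gamma> 0"
  obtain c where c: "c \<in> charts_at M (\<gamma> 0)" using ex_chart_at[OF M] by blast
  define D where "D = frechet_derivative (f \<circ> chart_inv c) (at (snd c (\<gamma> 0)))"
  have T: "?w \<in> tangent_space M (\<gamma> 0)"
    by (rule geodesic_velocity_in_tangent_space[OF M \<gamma>]) simp
  have cont: "continuous_on {0..1} \<gamma>" using \<gamma> by (simp add: geodesic_def)
  have "((f \<circ> \<gamma>) has_vector_derivative D (?w c)) (at 0 within {0..1})"
  proof (rule has_vector_derivative_along_curve[OF M c cont])
    show "((snd c \<circ> \<gamma>) has_vector_derivative ?w c) (at 0 within {0..1})"
      by (rule velocity_chart_has_vector_derivative[OF M, where \<gamma>=\<gamma>, OF c geodesic_chartD(1)[OF M \<gamma> _ c]]) simp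
    show "((f \<circ> chart_inv c) has_derivative D) (at (snd c (\<gamma> 0)))"
      using f c by (auto simp: D_def differentiable_function_def frechet_derivative_works)
  qed simp
  hence "((\<lambda>s. (f (\<gamma> s) - f (\<gamma> 0)) / (s - 0)) \<longlongrightarrow> D (?w c)) (at 0 within {0..1})"
    by (simp add: has_real_derivative_iff_has_vector_derivative[symmetric] has_field_derivative_iff)
  moreover have "eventually (\<lambda>s. 0 \<le> (f (\<gamma> s) - f (\<gamma> 0)) / (s - 0)) (at 0 within {0..1})"
  proof -
    obtain U where U: "open U" "\<gamma> 0 \<in> U" "\<forall>y\<in>S \<inter> U. f (\<gamma> 0) \<le> f y"
      using opt by (auto simp: local_optimal_solution_def)
    have "eventually (\<lambda>s. \<gamma> s \<in> U) (at 0 within {0..1})"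
      by (rule eventually_in_open[OF cont]) (use U in auto)
    moreover have "eventually (\<lambda>s::real. s \<in> {0..1}) (at 0 within {0..1})"
      by (simp add: eventually_at_filter)
    ultimately show ?thesis
    proof eventually_elim
      fix s assume "\<gamma> s \<in> U" "s \<in> {0..1}"
      hence "\<gamma> s \<in> S \<inter> U" using sub by blast
      with U(3) \<open>s \<in> {0..1}\<close> show "0 \<le> (f (\<gamma> s) - f (\<gamma> 0)) / (s - 0)" by simp
    qed
  qed
  moreover have "at (0::real) within {0..1} \<noteq> bot"
    by (simp add: trivial_limit_within islimpt_Icc)
  ultimately have "0 \<le> D (?w c)" by (rule tendsto_lowerbound)
  thus ?thesis using grad_properties[OF M f] T c by (auto simp: D_def)
qed

end

theorem theorem4p2:
  fixes M :: "('a::t2_space, 'n::finite) riem_struct"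
    and S :: "'a set"
    and f :: "'a \<Rightarrow> real"
    and xbar :: 'a
  assumes "riemannian_manifold M"
    and "simply_connected (UNIV :: 'a set)"
    and "S \<noteq> {}"
    and "geodesic_convex M S"
    and "differentiable_function M f"
    and "local_optimal_solution f S xbar"
    and "locally_geodesic_convex M S"
  shows "\<forall>\<epsilon>. local_convexity_radii M S \<epsilon> \<longrightarrow> tuminus (grad M f xbar) \<in> normal_cone M S \<epsilon> xbar"
proof (intro allI impI)
  fix \<epsilon> assume \<epsilon>: "local_convexity_radii M S \<epsilon>"
  note M = assms(1)
  let ?T = "tangent_space M xbar" and ?g = "grad M f xbar"
  have gT: "?g \<in> ?T" using grad_properties[OF M assms(5)] by blast
  have uT: "tuminus ?g \<in> ?T"
    by (simp add: tuminus_eq_tscale tscale_in_tangent_space[OF M gT])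
  have "metric M xbar (tuminus ?g) v \<le> 0" if v: "v \<in> tangent_cone M S \<epsilon> xbar" for v
  proof (cases "v = tzero")
    case True
    thus ?thesis using metric_tzero_right[OF M uT] by simp
  next
    case False
    then obtain t where vT: "v \<in> ?T" and t: "0 < t" "t < \<epsilon> xbar"
      and dom: "tscale (t / tnorm M xbar v) v \<in> exp_domain M xbar"
      and int: "exp_map M xbar (tscale (t / tnorm M xbar v) v) \<in> rel_int M S"
      using v by (auto simp: tangent_cone_def)
    \<comment> \<open>The factor that scales \<open>v\<close> to norm \<open>t\<close>.\<close>
    define a where "a = t / tnorm M xbar v"
    let ?w = "tscale a v"
    have nv: "tnorm M xbar v > 0"
      using metric_pos[OF M vT False] by (simp add: tnorm_def)
    have a: "a > 0" using t nv by (simp add: a_def)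
    have "metric M xbar ?w ?w = a\<^sup>2 * metric M xbar v v"
      using vT tscale_in_tangent_space[OF M vT]
      by (simp add: metric_scale_left[OF M] metric_scale_right[OF M] power2_eq_square)
    hence nw: "tnorm M xbar ?w = t"
      using a nv t by (simp add: tnorm_def real_sqrt_mult a_def)
    have "\<exists>q. \<exists>\<gamma>. geodesic M \<gamma> \<and> \<gamma> 0 = xbar \<and> velocity M {0..1} \<gamma> 0 = ?w \<and> \<gamma> 1 = q"
      using dom by (auto simp: exp_domain_def a_def)
    from someI_ex[OF this]
    obtain \<gamma> where \<gamma>: "geodesic M \<gamma>" "\<gamma> 0 = xbar" "velocity M {0..1} \<gamma> 0 = ?w"
      "\<gamma> 1 = exp_map M xbar ?w"
      unfolding exp_map_def by blast
    have "\<gamma> 1 \<in> S" using int \<gamma>(4) by (auto simp: rel_int_def a_def)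
    moreover have "\<gamma> 0 \<in> S" using assms(6) \<gamma>(2) by (simp add: local_optimal_solution_def)
    ultimately have "\<gamma> ` {0..1} \<subseteq> S"
      using short_geodesic_subset[OF M \<epsilon> \<gamma>(1)] \<gamma> nw t by simp
    hence "metric M xbar ?g ?w \<ge> 0"
      using grad_along_geodesic_nonneg[OF M assms(5) _ \<gamma>(1), of S] assms(6) \<gamma> by simp
    hence "metric M xbar ?g v \<ge> 0"
      using a by (simp add: metric_scale_right[OF M gT vT] zero_le_mult_iff)
    thus ?thesis
      by (simp add: tuminus_eq_tscale metric_scale_left[OF M gT vT])
  qed
  with uT show "tuminus ?g \<in> normal_cone M S \<epsilon> xbar" by (simp add: normal_cone_def)
qed

end
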